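(* Let $\alpha\neq0$ be a simple root of $f(x)=0$ (so $f'(\alpha)\ne0$) with $f''(\alpha)\neq 0$, and let $q\neq 0$ be a real number. If $$|\mu_q(\alpha^q)|\le|\mu(\alpha)|$$ and $$\left(q\alpha^{q-1}\right)^2\left(1+\left(\frac{f'(\alpha)}{q\alpha^{q-1}}\right)^2\right)^{3/2}\le\left(1+f'(\alpha)^2\right)^{3/2}$$ hold, then the convergence to $\alpha$ of the $q$th power of the binomial expansion of Newton's method (of any truncation order $N\ge1$) is equal to or faster than that of Newton's method.
   Context: $f$ is a real function of a real variable, $C^2$ near $\alpha$, and $g(t)=f(t^{1/q})$, so $g(x^q)=f(x)$. The curvatures are $\mu(x)=\frac{f''(x)}{(1+f'(x)^2)^{3/2}}$ and $\mu_q(t)=\frac{g''(t)}{(1+g'(t)^2)^{3/2}}$. Newton's method is $x_{k+1}=x_k-\frac{f(x_k)}{f'(x_k)}$. For an integer $N\ge1$, the $q$th power of the binomial expansion of Newton's method of truncation order $N$ is the recurrence $$x_{k+1}^q=\sum_{i=0}^{N}\binom{q}{i}x_k^{q-i}\left[-\frac{f(x_k)}{f'(x_k)}\right]^i,\qquad \binom{q}{i}=\frac{q(q-1)\cdots(q-i+1)}{i!}.$$ Real powers occurring are assumed to be defined as real numbers (e.g. positive base), and $t\mapsto t^{1/q}$ is the inverse of $x\mapsto x^q$ near $\alpha$. If a method has the form $x_{k+1}=\varphi(x_k)$, its asymptotic error constant at $\alpha$ is $\lim_{x\to\alpha}|\varphi(x)-\alpha|/(x-\alpha)^2$. "The convergence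 of method A to $\alpha$ is equal to or faster than that of method B" means that both methods converge to $\alpha$ from every initial value sufficiently close to $\alpha$, and the asymptotic error constant of A is at most that of B. *)

theory Defs
  imports "HOL-Analysis.Analysis"
begin

text \<open>
  Real powers \<open>x\<^sup>q\<close> with a possibly negative base.  A negative base is admitted exactly when
  \<open>q = p/r\<close> with integers \<open>p\<close> and odd \<open>r\<close>; then \<open>x\<^sup>q\<close> is the \<open>p\<close>-th power of the real \<open>r\<close>-th root
  of \<open>x\<close> (see \<open>real_power_root\<close> below).  The parity of \<open>p\<close> does not depend on the choice of the
  representation with odd \<open>r\<close>.
\<close>

definition real_power_defined :: "real \<Rightarrow> real \<Rightarrow> bool" where
  "real_power_defined x q \<longleftrightarrow>
     x > 0 \<or> (x < 0 \<and> (\<exists>p r :: int. odd r \<and> q = of_int p / of_int r))"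

definition real_power :: "real \<Rightarrow> real \<Rightarrow> real" where
  "real_power x q =
     (if x < 0 \<and> (\<exists>p r :: int. odd p \<and> odd r \<and> q = of_int p / of_int r)
      then - (\<bar>x\<bar> powr q) else \<bar>x\<bar> powr q)"

definition half_line :: "real \<Rightarrow> real set" where
  "half_line \<alpha> = {x. 0 < \<alpha> * x}"

text \<open>
  The map \<open>t \<mapsto> t\<^bsup>1/q\<^esup>\<close>, understood as the inverse of \<open>x \<mapsto> x\<^sup>q\<close> near \<open>\<alpha>\<close>.  For \<open>\<alpha> > 0\<close> it is the
  usual positive power; for \<open>\<alpha> < 0\<close> and, e.g., \<open>q = 2\<close> it is the negative square root.
\<close>

definition branch_root :: "real \<Rightarrow> real \<Rightarrow> real \<Rightarrow> real" where
  "branch_root \<alpha> q = inv_into (half_line \<alpha>) (\<lambda>x. real_power x q)"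

lemma real_power_pos: "x > 0 \<Longrightarrow> real_power x q = x powr q"
  by (simp add: real_power_def)

lemma real_power_root:
  fixes p :: int and r :: nat
  assumes "odd r" "x \<noteq> 0"
  shows "real_power x (of_int p / of_nat r) = root r x powi p"
proof -
  have r: "r > 0" using assms(1) by (simp add: odd_pos)
  have abs: "root r \<bar>x\<bar> powi p = \<bar>x\<bar> powr (of_int p / of_nat r)"
  proof -
    have "root r \<bar>x\<bar> powi p = root r \<bar>x\<bar> powr of_int p"
      using assms r by (simp add: powr_real_of_int')
    also have "\<dots> = (\<bar>x\<bar> powr (1 / of_nat r)) powr of_int p"
      using assms r by (simp add: root_powr_inverse)
    also have "\<dots> = \<bar>x\<bar> powr (of_int p / of_nat r)"
      by (simp only: powr_powr) simp
    finally show ?thesis .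
  qed
  show ?thesis
  proof (cases "x < 0")
    case False
    with abs show ?thesis by (simp add: real_power_def)
  next
    case True
    have rt: "root r x = - root r \<bar>x\<bar>"
      using True by (simp add: real_root_minus)
    have "(\<exists>p' r' :: int. odd p' \<and> odd r' \<and>
              (of_int p / of_nat r :: real) = of_int p' / of_int r') \<longleftrightarrow> odd p"
    proof
      assume "\<exists>p' r' :: int. odd p' \<and> odd r' \<and>
                (of_int p / of_nat r :: real) = of_int p' / of_int r'"
      then obtain p' r' :: int where *: "odd p'" "odd r'"
        "(of_int p / of_nat r :: real) = of_int p' / of_int r'" by blast
      have "r' \<noteq> 0" using *(2) by auto
      with *(3) r have "(of_int p :: real) * of_int r' = of_int p' * of_int (int r)"
        by (simp add: field_simps)
      then have "p * r' = p' * int r" by (metis of_int_eq_iff of_int_mult)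
      then have "odd (p * r')" using *(1) assms(1) by simp
      then show "odd p" by simp
    next
      assume "odd p"
      then have "odd p \<and> odd (int r) \<and> (of_int p / of_nat r :: real) = of_int p / of_int (int r)"
        using assms(1) by simp
      then show "\<exists>p' r' :: int. odd p' \<and> odd r' \<and>
                (of_int p / of_nat r :: real) = of_int p' / of_int r'" by blast
    qed
    then show ?thesis
      using True abs rt by (auto simp: real_power_def power_int_minus_left)
  qed
qed

lemma inj_on_real_power:
  assumes "q \<noteq> 0"
  shows "inj_on (\<lambda>x. real_power x q) (half_line \<alpha>)"
proof (rule inj_onI)
  fix x y assume xy: "x \<in> half_line \<alpha>" "y \<in> half_line \<alpha>" "real_power x q = real_power y q"
  then have s: "x < 0 \<longleftrightarrow> y < 0" "x \<noteq> 0" "y \<noteq> 0"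
    by (auto simp: half_line_def zero_less_mult_iff)
  with xy(3) have "\<bar>x\<bar> powr q = \<bar>y\<bar> powr q"
    by (auto simp: real_power_def split: if_splits)
  then have "(\<bar>x\<bar> powr q) powr (1 / q) = (\<bar>y\<bar> powr q) powr (1 / q)" by simp
  then have "\<bar>x\<bar> = \<bar>y\<bar>" using assms by (simp add: powr_powr)
  with s(1) show "x = y" by (auto simp: abs_if split: if_splits)
qed

lemma branch_root_real_power:
  "q \<noteq> 0 \<Longrightarrow> x \<in> half_line \<alpha> \<Longrightarrow> branch_root \<alpha> q (real_power x q) = x"
  unfolding branch_root_def
  by (rule inv_into_f_f[where f = "\<lambda>x. real_power x q"]) (auto intro: inj_on_real_power)

lemma branch_root_pos:
  assumes "\<alpha> > 0" "q \<noteq> 0" "t > 0"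
  shows "branch_root \<alpha> q t = t powr (1 / q)"
proof -
  have "t powr (1 / q) \<in> half_line \<alpha>" using assms by (simp add: half_line_def)
  moreover have "real_power (t powr (1 / q)) q = t"
    using assms by (simp add: real_power_pos powr_powr)
  ultimately show ?thesis using branch_root_real_power[of q "t powr (1 / q)" \<alpha>] assms by simp
qed

definition C2_near :: "(real \<Rightarrow> real) \<Rightarrow> real \<Rightarrow> bool" where
  "C2_near f a \<longleftrightarrow>
     (\<forall>\<^sub>F x in nhds a. f differentiable (at x) \<and> deriv f differentiable (at x) \<and>
                      isCont (deriv (deriv f)) x)"

definition curvature :: "(real \<Rightarrow> real) \<Rightarrow> real \<Rightarrow> real" where
  "curvature f x = deriv (deriv f) x / (1 + (deriv f x)\<^sup>2) powr (3/2)"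

definition power_transform :: "(real \<Rightarrow> real) \<Rightarrow> real \<Rightarrow> real \<Rightarrow> real \<Rightarrow> real" where
  "power_transform f \<alpha> q t = f (branch_root \<alpha> q t)"

text \<open>
  A one-step method is given by its iteration function together with the set of points at which
  a step is meaningful (so that Isabelle's totalised division, derivative and powers never matter).
\<close>

definition newton_step :: "(real \<Rightarrow> real) \<Rightarrow> real \<Rightarrow> real" where
  "newton_step f x = x - f x / deriv f x"

definition newton_dom :: "(real \<Rightarrow> real) \<Rightarrow> real set" where
  "newton_dom f = {x. f differentiable (at x) \<and> deriv f x \<noteq> 0}"

definition binomial_sum :: "(real \<Rightarrow> real) \<Rightarrow> real \<Rightarrow> nat \<Rightarrow> real \<Rightarrow> real" where
  "binomial_sum f q N x =
     (\<Sum>i=0..N. (q gchoose i) * real_power x (q - of_nat i) * (- (f x / deriv f x)) ^ i)"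

definition binomial_newton_step :: "(real \<Rightarrow> real) \<Rightarrow> real \<Rightarrow> real \<Rightarrow> nat \<Rightarrow> real \<Rightarrow> real" where
  "binomial_newton_step f \<alpha> q N x = branch_root \<alpha> q (binomial_sum f q N x)"

text \<open>
  On this set the step satisfies the implicit recurrence (see \<open>binomial_newton_step_recurrence\<close>).
\<close>

definition binomial_newton_dom :: "(real \<Rightarrow> real) \<Rightarrow> real \<Rightarrow> real \<Rightarrow> nat \<Rightarrow> real set" where
  "binomial_newton_dom f \<alpha> q N =
     {x \<in> newton_dom f. real_power_defined x q \<and>
        binomial_sum f q N x \<in> (\<lambda>y. real_power y q) ` half_line \<alpha>}"

lemma binomial_newton_step_recurrence:
  assumes "x \<in> binomial_newton_dom f \<alpha> q N"
  shows "real_power (binomial_newton_step f \<alpha> q N x) q =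
           (\<Sum>i=0..N. (q gchoose i) * real_power x (q - of_nat i) * (- (f x / deriv f x)) ^ i)"
  using assms f_inv_into_f[of "binomial_sum f q N x" "\<lambda>y. real_power y q" "half_line \<alpha>"]
  by (simp add: binomial_newton_dom_def binomial_newton_step_def branch_root_def binomial_sum_def)

definition locally_convergent :: "(real \<Rightarrow> real) \<Rightarrow> real set \<Rightarrow> real \<Rightarrow> bool" where
  "locally_convergent \<phi> D a \<longleftrightarrow>
     (\<exists>\<delta>>0. \<forall>x0. \<bar>x0 - a\<bar> < \<delta> \<longrightarrow>
        (\<forall>k. (\<phi> ^^ k) x0 \<in> D) \<and> (\<lambda>k. (\<phi> ^^ k) x0) \<longlonglongrightarrow> a)"

definition has_asymptotic_error_constant :: "(real \<Rightarrow> real) \<Rightarrow> real \<Rightarrow> real \<Rightarrow> bool" where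
  "has_asymptotic_error_constant \<phi> a C \<longleftrightarrow> ((\<lambda>x. \<bar>\<phi> x - a\<bar> / (x - a)\<^sup>2) \<longlongrightarrow> C) (at a)"

definition equal_or_faster ::
    "(real \<Rightarrow> real) \<Rightarrow> real set \<Rightarrow> (real \<Rightarrow> real) \<Rightarrow> real set \<Rightarrow> real \<Rightarrow> bool" where
  "equal_or_faster \<phi> D \<psi> E a \<longleftrightarrow>
     locally_convergent \<phi> D a \<and> locally_convergent \<psi> E a \<and>
     (\<exists>A B. has_asymptotic_error_constant \<phi> a A \<and> has_asymptotic_error_constant \<psi> a B \<and> A \<le> B)"

end

theory Submission
  imports Defs
begin

text \<open>
  With \<open>u = f x / f' x\<close> the truncated expansion factors as \<open>x\<^sup>q B(-u/x)\<close>, where \<open>B\<close> is the \<open>N\<close>-th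
  Taylor polynomial of \<open>(1 + w)\<^sup>q\<close>; hence the step is \<open>x B(-u/x)\<^bsup>1/q\<^esup>\<close>, whatever the sign of
  \<open>x\<close>.  Since \<open>B(w)\<^bsup>1/q\<^esup> = 1 + w + c w\<^sup>2 + o(w\<^sup>2)\<close>, the signed error constant of the
  method is \<open>f''(\<alpha>) / (2 f'(\<alpha>)) + c / \<alpha>\<close>.  For \<open>N \<ge> 2\<close> one has \<open>c = 0\<close>, which is Newton's
  constant.  For \<open>N = 1\<close> one has \<open>c = (1 - q) / 2\<close>, the constant is
  \<open>g''(\<alpha>\<^sup>q) (q \<alpha>\<^bsup>q-1\<^esup>)\<^sup>2 / (2 f'(\<alpha>))\<close>, and the two hypotheses multiply to
  \<open>\<bar>g''(\<alpha>\<^sup>q)\<bar> (q \<alpha>\<^bsup>q-1\<^esup>)\<^sup>2 \<le> \<bar>f''(\<alpha>)\<bar>\<close>.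
\<close>

section \<open>Real powers on a half-line\<close>

text \<open>Cross-multiplying two fractions for \<open>q\<close> with odd denominators shows that
  their numerators have the same parity, so any one such fraction decides the sign.\<close>

lemma real_power_neg:
  assumes "x < 0" "odd r" "q = of_int p / of_int r"
  shows "real_power x q = (if odd p then - (\<bar>x\<bar> powr q) else \<bar>x\<bar> powr q)"
proof -
  have "(\<exists>p' r' :: int. odd p' \<and> odd r' \<and> q = of_int p' / of_int r') \<longleftrightarrow> odd p"
  proof
    assume "\<exists>p' r' :: int. odd p' \<and> odd r' \<and> q = of_int p' / of_int r'"
    then obtain p' r' :: int where *: "odd p'" "odd r'" "q = of_int p' / of_int r'" by blast
    have "r \<noteq> 0" "r' \<noteq> 0" using assms(2) *(2) by auto
    with *(3) assms(3) have "(of_int p :: real) * of_int r' = of_int p' * of_int r"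
      by (simp add: field_simps)
    then have "p * r' = p' * r" by (metis of_int_eq_iff of_int_mult)
    then have "odd (p * r')" using *(1) assms(2) by simp
    then show "odd p" by simp
  qed (use assms in blast)
  with assms(1) show ?thesis by (simp add: real_power_def)
qed

text \<open>For negative \<open>x\<close>, lowering the exponent by \<open>i\<close> turns the
  numerator \<open>p\<close> into \<open>p - i * r\<close>. As \<open>r\<close> is odd, the parity
  changes exactly when \<open>i\<close> is odd, which matches the sign of
  \<open>x ^ i\<close>.\<close>

lemma real_power_diff_nat:
  assumes "real_power_defined x q"
  shows "real_power x (q - of_nat i) = real_power x q / x ^ i"
proof (cases "x > 0")
  case True
  then show ?thesis by (simp add: real_power_pos powr_diff powr_realpow)
next
  case False
  with assms obtain p r :: int where x: "x < 0" and r: "odd r" and q: "q = of_int p / of_int r"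
    by (auto simp: real_power_defined_def)
  have "r \<noteq> 0" using r by auto
  then have qi: "q - of_nat i = of_int (p - int i * r) / of_int r"
    by (simp add: q field_simps)
  have "\<bar>x\<bar> powr (q - of_nat i) = \<bar>x\<bar> powr q / \<bar>x\<bar> ^ i"
    using x by (simp add: powr_diff powr_realpow)
  moreover have "x ^ i = (if odd i then - (\<bar>x\<bar> ^ i) else \<bar>x\<bar> ^ i)"
    using x by (simp add: power_minus_odd)
  ultimately show ?thesis
    unfolding real_power_neg[OF x r q] real_power_neg[OF x r qi] using r by auto
qed

lemma real_power_mult_pos: "c > 0 \<Longrightarrow> real_power (x * c) q = real_power x q * c powr q"
  by (auto simp: real_power_def abs_mult mult_less_0_iff simp flip: powr_mult)

lemma real_power_nonzero: "x \<noteq> 0 \<Longrightarrow> real_power x q \<noteq> 0"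
  by (simp add: real_power_def)

lemma half_line_mult_pos: "x \<in> half_line a \<Longrightarrow> c > 0 \<Longrightarrow> x * c \<in> half_line a"
  by (auto simp: half_line_def zero_less_mult_iff mult_less_0_iff)

lemma half_line_self: "a \<noteq> 0 \<Longrightarrow> a \<in> half_line a"
  by (auto simp: half_line_def zero_less_mult_iff)

lemma eventually_half_line: "a \<noteq> 0 \<Longrightarrow> \<forall>\<^sub>F x in nhds a. x \<in> half_line a"
  using half_line_self by (intro eventually_nhds_in_open)
    (auto simp: half_line_def intro!: open_Collect_less continuous_intros)

lemma real_power_defined_half_line:
  "real_power_defined a q \<Longrightarrow> x \<in> half_line a \<Longrightarrow> real_power_defined x q"
  by (auto simp: real_power_defined_def half_line_def zero_less_mult_iff)

text \<open>A positive factor does not leave the half-line on which the branch inverts the power, so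
  the root acts on that factor as an ordinary \<open>powr\<close>, for either sign of
  \<open>a\<close>.\<close>

lemma branch_root_mult_pos:
  assumes "q \<noteq> 0" "x \<in> half_line a" "c > 0"
  shows "branch_root a q (real_power x q * c) = x * c powr (1 / q)"
  using branch_root_real_power[OF assms(1) half_line_mult_pos[OF assms(2), of "c powr (1 / q)"]]
    assms(1,3)
  by (simp add: real_power_mult_pos powr_powr)


section \<open>Second-order expansions and local convergence\<close>

text \<open>One application of l'Hopital's rule leaves half the difference quotient of
  \<open>f'\<close> at \<open>a\<close>.\<close>

lemma second_order_expansion:
  fixes f f' :: "real \<Rightarrow> real"
  assumes f: "\<forall>\<^sub>F x in nhds a. (f has_real_derivative f' x) (at x)"
    and f': "(f' has_real_derivative d) (at a)"
  shows "((\<lambda>x. (f x - f a - f' a * (x - a)) / (x - a)\<^sup>2) \<longlongrightarrow> d / 2) (at a)"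
proof (rule lhopital[where f' = "\<lambda>x. f' x - f' a" and g' = "\<lambda>x. 2 * (x - a)"])
  have "isCont f a" using eventually_nhds_x_imp_x[OF f] by (rule DERIV_isCont)
  then have "(f \<longlongrightarrow> f a) (at a)" by (simp add: isCont_def)
  then show "((\<lambda>x. f x - f a - f' a * (x - a)) \<longlongrightarrow> 0) (at a)"
    by (auto intro!: tendsto_eq_intros)
  show "((\<lambda>x. (x - a)\<^sup>2) \<longlongrightarrow> 0) (at a)" by (auto intro!: tendsto_eq_intros)
  show "\<forall>\<^sub>F x in at a. (x - a)\<^sup>2 \<noteq> 0" "\<forall>\<^sub>F x in at a. 2 * (x - a) \<noteq> 0"
    by (auto simp: eventually_at_filter)
  show "\<forall>\<^sub>F x in at a. ((\<lambda>x. f x - f a - f' a * (x - a)) has_real_derivative f' x - f' a) (at x)"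
    unfolding eventually_at_filter using f
    by eventually_elim (auto intro!: derivative_eq_intros)
  show "\<forall>\<^sub>F x in at a. ((\<lambda>x. (x - a)\<^sup>2) has_real_derivative 2 * (x - a)) (at x)"
    by (intro always_eventually allI) (auto intro!: derivative_eq_intros)
  have "((\<lambda>x. (f' x - f' a) / (x - a) / 2) \<longlongrightarrow> d / 2) (at a)"
    using f' by (intro tendsto_intros) (auto simp: has_field_derivative_iff)
  then show "((\<lambda>x. (f' x - f' a) / (2 * (x - a))) \<longlongrightarrow> d / 2) (at a)"
    by (simp add: field_simps)
qed

lemma powr_second_order_expansion:
  "((\<lambda>z::real. ((1 + z) powr r - 1 - r * z) / z\<^sup>2) \<longlongrightarrow> r * (r - 1) / 2) (at 0)"
proof -
  have "\<forall>\<^sub>F z::real in nhds 0. z > -1"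
    using eventually_nhds_in_open[of "{-1<..}" "0 :: real"] by simp
  then have "\<forall>\<^sub>F z in nhds 0. ((\<lambda>z. (1 + z) powr r) has_real_derivative r * (1 + z) powr (r - 1)) (at z)"
    by eventually_elim (auto intro!: derivative_eq_intros)
  moreover have "((\<lambda>z. r * (1 + z) powr (r - 1)) has_real_derivative r * (r - 1)) (at 0)"
    by (auto intro!: derivative_eq_intros)
  ultimately show ?thesis
    using second_order_expansion[of "\<lambda>z. (1 + z) powr r" "\<lambda>z. r * (1 + z) powr (r - 1)" 0 "r * (r - 1)"]
    by simp
qed

text \<open>Multiplying the limit by \<open>x - a\<close> shows that the error ratio tends to 0.
  Hence on a small ball inside \<open>D\<close> each step at least halves the error, and the
  iterates never leave the ball.\<close>

lemma locally_convergent_quadratic: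
  assumes lim: "((\<lambda>x. (\<phi> x - a) / (x - a)\<^sup>2) \<longlongrightarrow> C) (at a)"
    and fixpoint: "\<phi> a = a"
    and D: "\<forall>\<^sub>F x in nhds a. x \<in> D"
  shows "locally_convergent \<phi> D a"
proof -
  have "((\<lambda>x. (\<phi> x - a) / (x - a)\<^sup>2 * (x - a)) \<longlongrightarrow> C * 0) (at a)"
    using lim by (intro tendsto_mult) (auto intro!: tendsto_eq_intros)
  then have "\<forall>\<^sub>F x in at a. dist ((\<phi> x - a) / (x - a)\<^sup>2 * (x - a)) 0 < 1 / 2"
    by (intro tendstoD) auto
  then have "\<forall>\<^sub>F x in at a. \<bar>\<phi> x - a\<bar> \<le> \<bar>x - a\<bar> / 2"
    using eventually_neq_at_within[of a a UNIV]
    by eventually_elim (simp add: power2_eq_square pos_divide_less_eq)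
  \<comment> \<open>The punctured limit says nothing at \<open>a\<close>; the fixed-point equation
    supplies that starting value.\<close>
  then have "\<forall>\<^sub>F x in nhds a. \<bar>\<phi> x - a\<bar> \<le> \<bar>x - a\<bar> / 2"
    unfolding eventually_at_filter by eventually_elim (auto simp: fixpoint)
  with D have "\<forall>\<^sub>F x in nhds a. x \<in> D \<and> \<bar>\<phi> x - a\<bar> \<le> \<bar>x - a\<bar> / 2"
    by (rule eventually_conj)
  then obtain \<delta> where \<delta>: "\<delta> > 0"
    and near: "\<And>x. \<bar>x - a\<bar> < \<delta> \<Longrightarrow> x \<in> D \<and> \<bar>\<phi> x - a\<bar> \<le> \<bar>x - a\<bar> / 2"
    unfolding eventually_nhds_metric dist_real_def by blast
  have "(\<forall>k. (\<phi> ^^ k) x0 \<in> D) \<and> (\<lambda>k. (\<phi> ^^ k) x0) \<longlonglongrightarrow> a" if x0: "\<bar>x0 - a\<bar> < \<delta>" for x0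
  proof -
    have bound: "\<bar>(\<phi> ^^ k) x0 - a\<bar> < \<delta> \<and> \<bar>(\<phi> ^^ k) x0 - a\<bar> \<le> \<bar>x0 - a\<bar> * (1 / 2) ^ k" for k
    proof (induction k)
      case (Suc k)
      with near[of "(\<phi> ^^ k) x0"] have "\<bar>(\<phi> ^^ Suc k) x0 - a\<bar> \<le> \<bar>(\<phi> ^^ k) x0 - a\<bar> / 2" by simp
      with Suc \<open>\<delta> > 0\<close> show ?case by (auto simp del: funpow.simps)
    qed (use x0 in simp)
    have "(\<lambda>k. (\<phi> ^^ k) x0 - a) \<longlonglongrightarrow> 0"
    proof (rule Lim_null_comparison)
      show "\<forall>\<^sub>F k in sequentially. norm ((\<phi> ^^ k) x0 - a) \<le> \<bar>x0 - a\<bar> * (1 / 2) ^ k"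
        using bound by simp
      show "(\<lambda>k. \<bar>x0 - a\<bar> * (1 / 2) ^ k) \<longlonglongrightarrow> 0"
        by (intro tendsto_mult_right_zero LIMSEQ_power_zero) simp
    qed
    then show ?thesis using bound near by (simp add: LIM_zero_iff)
  qed
  with \<delta> show ?thesis unfolding locally_convergent_def by blast
qed

lemma has_asymptotic_error_constant_abs:
  assumes "((\<lambda>x. (\<phi> x - a) / (x - a)\<^sup>2) \<longlongrightarrow> C) (at a)"
  shows "has_asymptotic_error_constant \<phi> a \<bar>C\<bar>"
  using tendsto_rabs[OF assms] by (simp add: has_asymptotic_error_constant_def)


section \<open>Newton's method\<close>

lemma C2_near_DERIV:
  assumes "C2_near f a"
  shows "\<forall>\<^sub>F x in nhds a. (f has_real_derivative deriv f x) (at x)"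
    and "(deriv f has_real_derivative deriv (deriv f) a) (at a)"
proof -
  show "\<forall>\<^sub>F x in nhds a. (f has_real_derivative deriv f x) (at x)"
    using assms unfolding C2_near_def
    by eventually_elim (simp add: DERIV_deriv_iff_real_differentiable)
  show "(deriv f has_real_derivative deriv (deriv f) a) (at a)"
    using eventually_nhds_x_imp_x[OF assms[unfolded C2_near_def]]
    by (simp add: DERIV_deriv_iff_real_differentiable)
qed

lemma eventually_newton_dom:
  assumes "C2_near f a" "deriv f a \<noteq> 0"
  shows "\<forall>\<^sub>F x in nhds a. x \<in> newton_dom f"
proof -
  have "isCont (deriv f) a" by (rule DERIV_isCont[OF C2_near_DERIV(2)[OF assms(1)]])
  then have "(deriv f \<longlongrightarrow> deriv f a) (nhds a)"
    by (simp add: isCont_def tendsto_nhds_iff)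
  then have "\<forall>\<^sub>F x in nhds a. deriv f x \<noteq> 0"
    using assms(2) by (rule tendsto_imp_eventually_ne)
  with C2_near_DERIV(1)[OF assms(1)] show ?thesis
    by eventually_elim (auto simp: newton_dom_def real_differentiable_def)
qed

text \<open>Since \<open>f a = 0\<close>, the Newton error is
  \<open>((x - a) * deriv f x - f x) / deriv f x\<close>. Its numerator over
  \<open>(x - a)\<^sup>2\<close> is the difference quotient of \<open>deriv f\<close> minus the
  second-order Taylor quotient of \<open>f\<close>, which tend to the second derivative and to half
  of it.\<close>

lemma newton_step_quadratic:
  assumes "C2_near f a" "f a = 0" "deriv f a \<noteq> 0"
  shows "((\<lambda>x. (newton_step f x - a) / (x - a)\<^sup>2) \<longlongrightarrow> deriv (deriv f) a / (2 * deriv f a)) (at a)"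
proof -
  note D = C2_near_DERIV[OF assms(1)]
  have "(deriv f \<longlongrightarrow> deriv f a) (at a)"
    using DERIV_isCont[OF D(2)] by (simp add: isCont_def)
  then have "((\<lambda>x. ((deriv f x - deriv f a) / (x - a)
        - (f x - f a - deriv f a * (x - a)) / (x - a)\<^sup>2) / deriv f x)
      \<longlongrightarrow> (deriv (deriv f) a - deriv (deriv f) a / 2) / deriv f a) (at a)"
    using D(2) second_order_expansion[OF D] assms(3)
    by (intro tendsto_divide[OF tendsto_diff]) (auto simp: has_field_derivative_iff)
  moreover have "\<forall>\<^sub>F x in at a. ((deriv f x - deriv f a) / (x - a)
        - (f x - f a - deriv f a * (x - a)) / (x - a)\<^sup>2) / deriv f x
      = (newton_step f x - a) / (x - a)\<^sup>2"
    unfolding eventually_at_filter using eventually_newton_dom[OF assms(1,3)]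
    by eventually_elim
      (auto simp: newton_dom_def newton_step_def assms(2) power2_eq_square divide_simps,
       auto simp: algebra_simps)
  ultimately show ?thesis
    by (subst (asm) tendsto_cong) (auto simp: field_simps)
qed

text \<open>The increment is \<open>x - a\<close> minus the Newton error, and the latter is of
  second order. This later allows squares of the increment to be measured in units of
  \<open>(x - a)\<^sup>2\<close>.\<close>

lemma newton_increment_tendsto:
  assumes "C2_near f a" "f a = 0" "deriv f a \<noteq> 0"
  shows "((\<lambda>x. f x / deriv f x / (x - a)) \<longlongrightarrow> 1) (at a)"
proof -
  have "((\<lambda>x. 1 - (newton_step f x - a) / (x - a)\<^sup>2 * (x - a))
      \<longlongrightarrow> 1 - deriv (deriv f) a / (2 * deriv f a) * (a - a)) (at a)"
    by (intro tendsto_intros newton_step_quadratic[OF assms])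
  moreover have "\<forall>\<^sub>F x in at a. 1 - (newton_step f x - a) / (x - a)\<^sup>2 * (x - a)
      = f x / deriv f x / (x - a)"
    using eventually_neq_at_within[of a a UNIV]
  proof eventually_elim
    case (elim x)
    then have "1 - (newton_step f x - a) / (x - a)\<^sup>2 * (x - a)
      = ((x - a) - (newton_step f x - a)) / (x - a)"
      unfolding diff_divide_distrib[of "x - a"] by (simp add: power2_eq_square)
    then show ?case by (simp add: newton_step_def)
  qed
  ultimately show ?thesis by (subst (asm) tendsto_cong) auto
qed


section \<open>The binomial expansion\<close>

definition binomial_poly :: "real \<Rightarrow> nat \<Rightarrow> real \<Rightarrow> real" where
  "binomial_poly q N w = (\<Sum>i=0..N. (q gchoose i) * w ^ i)"

lemma binomial_poly_0 [simp]: "binomial_poly q N 0 = 1"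
  by (simp add: binomial_poly_def sum.atLeast_Suc_atMost)

lemma continuous_binomial_poly: "isCont (binomial_poly q N) w"
  unfolding binomial_poly_def by (intro continuous_intros)

lemma binomial_sum_factor:
  assumes "real_power_defined x q"
  shows "binomial_sum f q N x = real_power x q * binomial_poly q N (- (f x / deriv f x) / x)"
  unfolding binomial_sum_def binomial_poly_def real_power_diff_nat[OF assms]
    sum_distrib_left power_divide
  by (intro sum.cong) simp_all

text \<open>The explicit point \<open>?y\<close> lies on the half-line of \<open>a\<close>, and its
  \<open>q\<close>-th power is the truncated sum. It is therefore also the witness that the step is
  meaningful at \<open>x\<close>.\<close>

lemma
  assumes "q \<noteq> 0" "real_power_defined a q" "x \<in> half_line a" "x \<in> newton_dom f"
    and pos: "binomial_poly q N (- (f x / deriv f x) / x) > 0"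
  shows binomial_newton_step_eq: "binomial_newton_step f a q N x
            = x * binomial_poly q N (- (f x / deriv f x) / x) powr (1 / q)" (is "_ = ?y")
    and binomial_newton_dom_memberI: "x \<in> binomial_newton_dom f a q N"
proof -
  have def: "real_power_defined x q"
    using assms(2,3) by (rule real_power_defined_half_line)
  show "binomial_newton_step f a q N x = ?y"
    by (simp only: binomial_newton_step_def binomial_sum_factor[OF def]
        branch_root_mult_pos[OF assms(1,3) pos])
  have "real_power ?y q = binomial_sum f q N x"
    using pos assms(1) by (simp add: binomial_sum_factor[OF def] real_power_mult_pos powr_powr)
  moreover have "?y \<in> half_line a"
    using pos assms(3) by (intro half_line_mult_pos) auto
  ultimately show "x \<in> binomial_newton_dom f a q N"
    using def assms(4) unfolding binomial_newton_dom_def by (blast intro: sym)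
qed

text \<open>Write the polynomial as \<open>1 + z w\<close> and expand
  \<open>(1 + z) powr (1 / q)\<close> to second order in \<open>z\<close>. The quadratic term
  contributes \<open>(1 - q) / 2\<close>, and the degree-2 term of the polynomial contributes
  \<open>R 0 / q\<close>, which is 0 for \<open>N = 1\<close> and cancels the former for larger
  \<open>N\<close>.\<close>

lemma binomial_poly_root_expansion:
  assumes "q \<noteq> 0" "N \<ge> 1"
  shows "((\<lambda>w. (binomial_poly q N w powr (1 / q) - 1 - w) / w\<^sup>2)
           \<longlongrightarrow> (if N = 1 then (1 - q) / 2 else 0)) (at 0)"
proof -
  define R where "R w = (\<Sum>i=2..N. (q gchoose i) * w ^ (i - 2))" for w
  define z where "z w = q * w + w\<^sup>2 * R w" for w
  have B: "binomial_poly q N w = 1 + z w" for w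
  proof -
    have "binomial_poly q N w = 1 + (q * w + (\<Sum>i=2..N. (q gchoose i) * w ^ i))"
      using assms(2) by (simp add: binomial_poly_def sum.atLeast_Suc_atMost numeral_2_eq_2)
    also have "(\<Sum>i=2..N. (q gchoose i) * w ^ i) = w\<^sup>2 * R w"
      unfolding R_def sum_distrib_left
    proof (intro sum.cong refl)
      fix i assume "i \<in> {2..N}"
      then have "w ^ i = w\<^sup>2 * w ^ (i - 2)" 
        by (subst power_add[symmetric], subst le_add_diff_inverse) auto
      then show "(q gchoose i) * w ^ i = w\<^sup>2 * ((q gchoose i) * w ^ (i - 2))" by simp
    qed
    finally show ?thesis by (simp add: z_def)
  qed
  have R0: "R 0 = (if N = 1 then 0 else q * (q - 1) / 2)"
  proof (cases "N = 1")
    case False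
    with assms(2) have "2 \<le> N" by simp
    \<comment> \<open>At \<open>w = 0\<close> only the term \<open>i = 2\<close> survives, because
      \<open>0 ^ 0 = 1\<close>.\<close>
    then have "R 0 = (q gchoose 2) + (\<Sum>i=Suc 2..N. (q gchoose i) * 0 ^ (i - 2))"
      unfolding R_def by (subst sum.atLeast_Suc_atMost) auto
    also have "(\<Sum>i=Suc 2..N. (q gchoose i) * 0 ^ (i - 2)) = 0"
      by (intro sum.neutral) auto
    finally show ?thesis
      using False by (simp add: gbinomial_prod_rev numeral_2_eq_2)
  qed (simp add: R_def)
  have "isCont R 0" unfolding R_def by (intro continuous_intros)
  then have Rlim: "(R \<longlongrightarrow> R 0) (at 0)" by (simp add: isCont_def)
  then have "((\<lambda>w. q + w * R w) \<longlongrightarrow> q) (at 0)"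
    by (auto intro!: tendsto_eq_intros)
  moreover have "\<forall>\<^sub>F w in at 0. q + w * R w = z w / w"
    by (auto simp: eventually_at_filter z_def field_simps power2_eq_square)
  ultimately have ratio: "((\<lambda>w. z w / w) \<longlongrightarrow> q) (at 0)"
    by (subst (asm) tendsto_cong)
  \<comment> \<open>The expansion in \<open>z\<close> is a punctured limit, so substituting
    \<open>z w\<close> requires it to avoid 0.\<close>
  have nz: "\<forall>\<^sub>F w in at 0. z w \<noteq> 0"
    using tendsto_imp_eventually_ne[OF ratio assms(1)] by eventually_elim auto
  have "(z \<longlongrightarrow> 0) (at 0)"
    unfolding z_def using Rlim by (auto intro!: tendsto_eq_intros)
  with nz have "filterlim z (at 0) (at 0)" by (simp add: filterlim_at)
  \<comment> \<open>The factor \<open>(z w / w)\<^sup>2\<close> changes the denominator from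
    \<open>(z w)\<^sup>2\<close> to \<open>w\<^sup>2\<close>; the summand \<open>R w / q\<close>
    restores the difference between \<open>z w / q\<close> and \<open>w\<close>.\<close>
  from filterlim_compose[OF powr_second_order_expansion[of "1 / q"] this]
  have "((\<lambda>w. ((1 + z w) powr (1 / q) - 1 - 1 / q * z w) / (z w)\<^sup>2 * (z w / w)\<^sup>2 + R w / q)
      \<longlongrightarrow> 1 / q * (1 / q - 1) / 2 * q\<^sup>2 + R 0 / q) (at 0)"
    by (intro tendsto_add tendsto_mult tendsto_power ratio tendsto_divide[OF Rlim tendsto_const assms(1)])
  moreover have "\<forall>\<^sub>F w in at 0.
      ((1 + z w) powr (1 / q) - 1 - 1 / q * z w) / (z w)\<^sup>2 * (z w / w)\<^sup>2 + R w / q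
      = (binomial_poly q N w powr (1 / q) - 1 - w) / w\<^sup>2"
    using nz eventually_neq_at_within[of 0 0 UNIV]
  proof eventually_elim
    case (elim w)
    have "((1 + z w) powr (1 / q) - 1 - 1 / q * z w) / (z w)\<^sup>2 * (z w / w)\<^sup>2 + R w / q
      = ((1 + z w) powr (1 / q) - 1 - z w / q + w\<^sup>2 * R w / q) / w\<^sup>2"
      using elim by (simp add: power_divide add_divide_distrib)
    also have "z w / q = w + w\<^sup>2 * R w / q"
      using assms(1) by (simp add: z_def add_divide_distrib)
    finally show ?case by (simp add: B)
  qed
  moreover have "1 / q * (1 / q - 1) / 2 * q\<^sup>2 + R 0 / q = (if N = 1 then (1 - q) / 2 else 0)"
    using assms(1) by (auto simp: R0 field_simps power2_eq_square)
  ultimately show ?thesis by (subst (asm) tendsto_cong) auto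
qed

text \<open>At the root the increment vanishes and the polynomial factor equals 1; by continuity it
  stays positive nearby.\<close>

lemma binomial_newton_local:
  assumes "C2_near f a" "a \<noteq> 0" "f a = 0" "deriv f a \<noteq> 0" "q \<noteq> 0" "real_power_defined a q"
  shows "\<forall>\<^sub>F x in nhds a. x \<in> binomial_newton_dom f a q N \<and> binomial_newton_step f a q N x
            = x * binomial_poly q N (- (f x / deriv f x) / x) powr (1 / q)"
proof -
  have "isCont f a" "isCont (deriv f) a"
    using C2_near_DERIV[OF assms(1)] by (auto dest: eventually_nhds_x_imp_x intro: DERIV_isCont)
  then have "isCont (\<lambda>x. - (f x / deriv f x) / x) a"
    using assms by (intro continuous_intros) auto
  from isCont_o2[OF this continuous_binomial_poly[of _ q N]]
  have "((\<lambda>x. binomial_poly q N (- (f x / deriv f x) / x)) \<longlongrightarrow> 1) (nhds a)"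
    using assms by (simp add: isCont_def tendsto_nhds_iff)
  then have "\<forall>\<^sub>F x in nhds a. binomial_poly q N (- (f x / deriv f x) / x) > 0"
    by (rule order_tendstoD) simp
  with eventually_half_line[OF assms(2)] eventually_newton_dom[OF assms(1,4)]
  show ?thesis
    by eventually_elim
      (use assms binomial_newton_step_eq binomial_newton_dom_memberI in blast)
qed

text \<open>With \<open>x * w x = - u x\<close>, the step equals the Newton step plus
  \<open>h (w x) * (u x)\<^sup>2 / x\<close>. Since \<open>u x / (x - a)\<close> tends to 1, this
  correction adds the limit of \<open>h (w x)\<close>, divided by \<open>a\<close>, to Newton's
  constant.\<close>

lemma binomial_newton_step_quadratic:
  assumes "C2_near f a" "a \<noteq> 0" "f a = 0" "deriv f a \<noteq> 0" "q \<noteq> 0" "real_power_defined a q" "N \<ge> 1"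
  shows "((\<lambda>x. (binomial_newton_step f a q N x - a) / (x - a)\<^sup>2)
    \<longlongrightarrow> deriv (deriv f) a / (2 * deriv f a) + (if N = 1 then (1 - q) / 2 else 0) / a) (at a)"
proof -
  define u where "u x = f x / deriv f x" for x
  define w where "w x = - u x / x" for x
  define h where "h v = (binomial_poly q N v powr (1 / q) - 1 - v) / v\<^sup>2" for v
  have u: "((\<lambda>x. u x / (x - a)) \<longlongrightarrow> 1) (at a)"
    unfolding u_def using newton_increment_tendsto assms(1,3,4) by blast
  have unz: "\<forall>\<^sub>F x in at a. u x \<noteq> 0"
    using tendsto_imp_eventually_ne[OF u, of 0] by (auto elim: eventually_mono)
  have xnz: "\<forall>\<^sub>F x in at a. x \<noteq> 0"
    using tendsto_imp_eventually_ne[OF tendsto_ident_at assms(2)] .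
  have "isCont f a" "isCont (deriv f) a"
    using C2_near_DERIV[OF assms(1)] by (auto dest: eventually_nhds_x_imp_x intro: DERIV_isCont)
  then have "isCont w a"
    unfolding w_def u_def using assms by (intro continuous_intros) auto
  then have "(w \<longlongrightarrow> 0) (at a)" by (simp add: isCont_def w_def u_def assms)
  moreover have "\<forall>\<^sub>F x in at a. w x \<noteq> 0"
    using unz xnz by eventually_elim (simp add: w_def)
  ultimately have "filterlim w (at 0) (at a)" by (simp add: filterlim_at)
  from filterlim_compose[OF binomial_poly_root_expansion[OF assms(5,7)] this]
  have "((\<lambda>x. h (w x)) \<longlongrightarrow> (if N = 1 then (1 - q) / 2 else 0)) (at a)"
    by (simp add: h_def)
  then have "((\<lambda>x. (newton_step f x - a) / (x - a)\<^sup>2 + h (w x) * (u x / (x - a))\<^sup>2 / x)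
    \<longlongrightarrow> deriv (deriv f) a / (2 * deriv f a) + (if N = 1 then (1 - q) / 2 else 0) * 1\<^sup>2 / a) (at a)"
    using assms by (intro tendsto_intros newton_step_quadratic u) auto
  moreover have "\<forall>\<^sub>F x in at a.
      (newton_step f x - a) / (x - a)\<^sup>2 + h (w x) * (u x / (x - a))\<^sup>2 / x
      = (binomial_newton_step f a q N x - a) / (x - a)\<^sup>2"
    using unz xnz filter_leD[OF at_within_le_nhds binomial_newton_local[OF assms(1-6), of N]]
  proof eventually_elim
    case (elim x)
    have "binomial_newton_step f a q N x = x * binomial_poly q N (w x) powr (1 / q)"
      using elim by (simp add: w_def u_def)
    also have "binomial_poly q N (w x) powr (1 / q) = 1 + w x + h (w x) * (w x)\<^sup>2"
      using elim by (simp add: h_def w_def)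
    also have "x * (1 + w x + h (w x) * (w x)\<^sup>2) = newton_step f x + h (w x) * (u x)\<^sup>2 / x"
      using elim by (simp add: newton_step_def u_def[symmetric])
        (simp add: w_def field_simps power2_eq_square)
    finally show ?case
      by (simp add: add_divide_distrib diff_divide_distrib power_divide)
  qed
  ultimately show ?thesis by (subst (asm) tendsto_cong) auto
qed


section \<open>Curvature of the transformed function\<close>

text \<open>Near \<open>\<tau>\<close> the branch is
  \<open>\<rho> t = a * (t / \<tau>) powr (1 / q)\<close>, whose base is positive for either sign of
  \<open>a\<close>. The chain rule is applied twice to \<open>f (\<rho> t)\<close>; the factor
  \<open>q * real_power a (q - 1)\<close> is the reciprocal of
  \<open>\<rho>' \<tau>\<close>.\<close>

lemma power_transform_derivs:
  assumes "C2_near f a" "a \<noteq> 0" "q \<noteq> 0" "real_power_defined a q"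
  shows "deriv (power_transform f a q) (real_power a q)
           = deriv f a / (q * real_power a (q - 1))"
    and "deriv (deriv (power_transform f a q)) (real_power a q) * (q * real_power a (q - 1))\<^sup>2
           = deriv (deriv f) a + deriv f a * (1 - q) / a"
proof -
  define \<tau> where "\<tau> = real_power a q"
  define g where "g = power_transform f a q"
  define \<rho> where "\<rho> t = a * (t / \<tau>) powr (1 / q)" for t
  define \<rho>' where "\<rho>' t = a / (q * \<tau>) * (t / \<tau>) powr (1 / q - 1)" for t
  have \<tau>: "\<tau> \<noteq> 0" by (simp add: \<tau>_def real_power_nonzero assms(2))
  have p: "q * real_power a (q - 1) = q * \<tau> / a"
    using real_power_diff_nat[OF assms(4), of 1] by (simp add: \<tau>_def)
  have pos: "\<forall>\<^sub>F t in nhds \<tau>. t / \<tau> > 0"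
    using eventually_half_line[OF \<tau>]
    by eventually_elim (auto simp: half_line_def zero_less_divide_iff zero_less_mult_iff)
  then have g: "\<forall>\<^sub>F t in nhds \<tau>. g t = f (\<rho> t)"
  proof eventually_elim
    case (elim t)
    from branch_root_mult_pos[OF assms(3) half_line_self[OF assms(2)] this]
    show ?case using \<tau> by (simp add: g_def power_transform_def \<rho>_def \<tau>_def)
  qed
  have \<rho>: "(\<rho> has_real_derivative \<rho>' t) (at t)" if "t / \<tau> > 0" for t
    unfolding \<rho>_def \<rho>'_def using that \<tau>
    by (auto intro!: derivative_eq_intros simp: field_simps)
  have \<rho>\<tau>: "\<rho> \<tau> = a" "\<rho>' \<tau> = a / (q * \<tau>)" using \<tau> by (simp_all add: \<rho>_def \<rho>'_def)
  have \<rho>'': "(\<rho>' has_real_derivative a * (1 - q) / (q * \<tau>)\<^sup>2) (at \<tau>)"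
    unfolding \<rho>'_def using \<tau> assms(3)
    by (auto intro!: derivative_eq_intros simp: field_simps power2_eq_square)
  have "isCont \<rho> \<tau>" using \<rho>[of \<tau>] \<tau> by (auto intro: DERIV_isCont)
  then have "filterlim \<rho> (nhds a) (nhds \<tau>)"
    by (simp add: isCont_def tendsto_nhds_iff \<rho>\<tau>)
  then have "\<forall>\<^sub>F t in nhds \<tau>. (f has_real_derivative deriv f (\<rho> t)) (at (\<rho> t))"
    using C2_near_DERIV(1)[OF assms(1)] unfolding filterlim_iff by blast
  with pos have "\<forall>\<^sub>F t in nhds \<tau>.
      ((\<lambda>t. f (\<rho> t)) has_real_derivative deriv f (\<rho> t) * \<rho>' t) (at t)"
    by eventually_elim (intro DERIV_chain2 \<rho>)
  \<comment> \<open>Transferring the derivative at \<open>t\<close> needs agreement on a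
    neighbourhood of \<open>t\<close>, not merely at \<open>t\<close>.\<close>
  moreover have "\<forall>\<^sub>F t in nhds \<tau>. \<forall>\<^sub>F s in nhds t. g s = f (\<rho> s)"
    using g by (simp add: eventually_eventually)
  ultimately have g': "\<forall>\<^sub>F t in nhds \<tau>. deriv g t = deriv f (\<rho> t) * \<rho>' t"
  proof eventually_elim
    case (elim t)
    then show ?case using deriv_cong_ev[OF elim(2) refl] DERIV_imp_deriv by simp
  qed
  show "deriv (power_transform f a q) (real_power a q) = deriv f a / (q * real_power a (q - 1))"
    using eventually_nhds_x_imp_x[OF g'] unfolding p by (simp add: g_def[symmetric] \<tau>_def[symmetric] \<rho>\<tau>)
  have "((\<lambda>t. deriv f (\<rho> t) * \<rho>' t) has_real_derivative
      deriv (deriv f) a * \<rho>' \<tau> * \<rho>' \<tau> + a * (1 - q) / (q * \<tau>)\<^sup>2 * deriv f (\<rho> \<tau>)) (at \<tau>)"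
    by (intro DERIV_mult DERIV_chain2 \<rho> \<rho>'') (use C2_near_DERIV(2)[OF assms(1)] \<tau> in \<open>simp_all add: \<rho>\<tau>\<close>)
  then have "deriv (deriv g) \<tau>
      = deriv (deriv f) a * \<rho>' \<tau> * \<rho>' \<tau> + a * (1 - q) / (q * \<tau>)\<^sup>2 * deriv f (\<rho> \<tau>)"
    using deriv_cong_ev[OF g' refl] DERIV_imp_deriv by simp
  then have "deriv (deriv g) \<tau> * (q * \<tau> / a)\<^sup>2 = deriv (deriv f) a + deriv f a * (1 - q) / a"
    using \<tau> assms(2,3) by (simp add: \<rho>\<tau> field_simps power2_eq_square)
  then show "deriv (deriv (power_transform f a q)) (real_power a q) * (q * real_power a (q - 1))\<^sup>2
           = deriv (deriv f) a + deriv f a * (1 - q) / a"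
    unfolding p by (simp add: g_def \<tau>_def)
qed

text \<open>Multiplying the two inequalities between nonnegative quantities cancels the denominators
  of both curvatures.\<close>

lemma curvature_comparison:
  assumes "\<bar>curvature g t\<bar> \<le> \<bar>curvature f x\<bar>"
    and "p\<^sup>2 * (1 + (deriv g t)\<^sup>2) powr (3/2) \<le> (1 + (deriv f x)\<^sup>2) powr (3/2)"
  shows "\<bar>deriv (deriv g) t * p\<^sup>2\<bar> \<le> \<bar>deriv (deriv f) x\<bar>"
proof -
  define G where "G = (1 + (deriv g t)\<^sup>2) powr (3/2)"
  define F where "F = (1 + (deriv f x)\<^sup>2) powr (3/2)"
  have "1 + (deriv g t)\<^sup>2 > 0" "1 + (deriv f x)\<^sup>2 > 0" by (simp_all add: add_pos_nonneg)
  then have pos: "G > 0" "F > 0" unfolding G_def F_def by (metis powr_gt_zero less_irrefl)+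
  have "\<bar>deriv (deriv g) t * p\<^sup>2\<bar> = \<bar>curvature g t\<bar> * (p\<^sup>2 * G)"
    using pos by (simp add: curvature_def G_def[symmetric] abs_mult)
  also have "\<dots> \<le> \<bar>curvature f x\<bar> * F"
    using assms pos by (intro mult_mono) (auto simp: G_def F_def)
  also have "\<dots> = \<bar>deriv (deriv f) x\<bar>"
    using pos by (simp add: curvature_def F_def[symmetric])
  finally show ?thesis .
qed

section \<open>Comparison of the two asymptotic error constants\<close>

theorem theorem4p8:
  fixes f :: "real \<Rightarrow> real" and \<alpha> q :: real and N :: nat
  assumes "C2_near f \<alpha>"
    and "\<alpha> \<noteq> 0"
    and "f \<alpha> = 0" and "deriv f \<alpha> \<noteq> 0"
    and "deriv (deriv f) \<alpha> \<noteq> 0"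
    and "q \<noteq> 0"
    and "real_power_defined \<alpha> q"
    and "\<bar>curvature (power_transform f \<alpha> q) (real_power \<alpha> q)\<bar> \<le> \<bar>curvature f \<alpha>\<bar>"
    and "(q * real_power \<alpha> (q - 1))\<^sup>2 *
           (1 + (deriv f \<alpha> / (q * real_power \<alpha> (q - 1)))\<^sup>2) powr (3/2)
         \<le> (1 + (deriv f \<alpha>)\<^sup>2) powr (3/2)"
    and "N \<ge> 1"
  shows "equal_or_faster
           (binomial_newton_step f \<alpha> q N) (binomial_newton_dom f \<alpha> q N)
           (newton_step f) (newton_dom f) \<alpha>"
proof -
  define K where "K = deriv (deriv f) \<alpha> / (2 * deriv f \<alpha>)"
  define c where "c = (if N = 1 then (1 - q) / 2 else 0)"
  note newton = newton_step_quadratic[OF assms(1,3,4), folded K_def]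
  note binomial = binomial_newton_step_quadratic[OF assms(1-4,6,7,10), folded K_def c_def]
  note local = binomial_newton_local[OF assms(1-4,6,7), of N]
  note derivs = power_transform_derivs[OF assms(1,2,6,7)]
  \<comment> \<open>The formula for the first derivative of the transform brings the second
    hypothesis into the form required for the comparison; the one for the second derivative rewrites
    its conclusion.\<close>
  have "\<bar>deriv (deriv f) \<alpha> + deriv f \<alpha> * (1 - q) / \<alpha>\<bar> \<le> \<bar>deriv (deriv f) \<alpha>\<bar>"
    using curvature_comparison[OF assms(8), of "q * real_power \<alpha> (q - 1)"] assms(9)
    by (simp only: derivs)
  moreover have "K + (1 - q) / 2 / \<alpha>
      = (deriv (deriv f) \<alpha> + deriv f \<alpha> * (1 - q) / \<alpha>) / (2 * deriv f \<alpha>)"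
    using assms(2,4) by (simp add: K_def field_simps)
  ultimately have "\<bar>K + (1 - q) / 2 / \<alpha>\<bar> \<le> \<bar>K\<bar>"
    by (simp add: K_def divide_right_mono)
  \<comment> \<open>The case \<open>N = 1\<close> is the inequality just shown; for larger
    \<open>N\<close> both sides agree because \<open>c = 0\<close>.\<close>
  then have "\<bar>K + c / \<alpha>\<bar> \<le> \<bar>K\<bar>" by (simp add: c_def)
  moreover have "locally_convergent (newton_step f) (newton_dom f) \<alpha>"
    using newton eventually_newton_dom[OF assms(1,4)]
    by (intro locally_convergent_quadratic) (auto simp: newton_step_def assms(3))
  \<comment> \<open>Evaluating the local formula at \<alpha> itself gives the fixed point, since the
    polynomial factor is 1 there.\<close>
  moreover have "locally_convergent (binomial_newton_step f \<alpha> q N) (binomial_newton_dom f \<alpha> q N) \<alpha>"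
    using binomial eventually_nhds_x_imp_x[OF local] local
    by (intro locally_convergent_quadratic) (auto simp: assms(3) elim: eventually_mono)
  ultimately show ?thesis
    unfolding equal_or_faster_def
    using has_asymptotic_error_constant_abs[OF newton] has_asymptotic_error_constant_abs[OF binomial]
    by blast
qed

end
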